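(* Let $(X^*,z^* )$ be an optimal solution of the problem $$(\mathrm{P})\qquad \min_{X\in\mathbb{R}^{N\times N},\ z\in\mathcal{Z}}\ \operatorname{Tr}(\tilde W X)\quad\text{subject to}\quad \tilde L(z)X=I_N,$$ and suppose that $\underline{X}_{ij}\le X^*_{ij}\le \overline{X}_{ij}$ for all $i,j\in\mathcal{V}_r$, where $\underline{X}_{ij},\overline{X}_{ij}$ are given real numbers. Consider the mixed-integer linear program $(\mathrm{M})$ over the variables $X\in\mathbb{R}^{N\times N}$, $z\in\mathcal{Z}$ and $y=\{y_{mij}\}_{m\in\hat{\mathcal{E}},\,i,j\in\mathcal{V}_r}$ (real numbers): minimize $\operatorname{Tr}(\tilde W X)$ subject to $$\sum_{m\in\hat{\mathcal{E}}} b_m\sum_{k\in\mathcal{V}_r}[a_m a_m^\top]_{ik}\,y_{mkj}=[I_N]_{ij}\qquad\text{for all } i,j\in\mathcal{V}_r$$ (that is, the constraint $\tilde L(z)X=I_N$ with each product $z_mX_{ij}$ replaced by $y_{mij}$), and, for all $m\in\hat{\mathcal{E}}$ and $i,j\in\mathcal{V}_r$, $$y_{mij}\ge z_m\underline{X}_{ij},\qquad y_{mij}\ge X_{ij}+z_m\overline{X}_{ij}-\overline{X}_{ij},$$ $$y_{mij}\le z_m\overline{X}_{ij},\qquad y_{mij}\le X_{ij}+z_m\underline{X}_{ij}-\underline{X}_{ij}.$$ Then $(\mathrm{M})$ is an exact reformulation of $(\mathrm{P})$: the two problems have the same optimal value, and every optimal solution $(X,z,y)$ of $(\mathrm{M})$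 satisfies $y_{mij}=z_mX_{ij}$ for all $m\in\hat{\mathcal{E}}$, $i,j\in\mathcal{V}_r$, and $(X,z)$ is an optimal solution of $(\mathrm{P})$.
   Context: Let $\hat{\mathcal{G}}=(\mathcal{V},\hat{\mathcal{E}})$ be an undirected graph with nodes $\mathcal{V}=\{0,1,\dots,N\}$ and candidate lines (edges) $\hat{\mathcal{E}}$; each line $m=(i,j)\in\hat{\mathcal{E}}$ has susceptance $b_m=b_{ij}>0$. Node $0$ is the reference node and $\mathcal{V}_r=\mathcal{V}\setminus\{0\}=\{1,\dots,N\}$. For each line $m=(i,j)$ (with an arbitrary fixed orientation), $a_m=a_{ij}\in\mathbb{R}^N$ is the vector indexed by $\mathcal{V}_r$ with $n$-th entry $+1$ if $n=i$, $-1$ if $n=j$, and $0$ otherwise. For an integer budget $K\ge N$, $\mathcal{Z}=\{z\in\{0,1\}^{|\hat{\mathcal{E}}|}:\ \sum_{m\in\hat{\mathcal{E}}}z_m\le K\}$. For $z\in\mathcal{Z}$, $\tilde L(z)=\sum_{m\in\hat{\mathcal{E}}}z_m b_m a_m a_m^\top\in\mathbb{R}^{N\times N}$ is the reduced susceptance Laplacian of the graph formed by the selected lines. $W$ is the Laplacian matrix of a connected graph on $\mathcal{V}$ with non-negative edge weights, and $\tilde W\in\mathbb{R}^{N\times N}$ is obtained from $W$ by deleting the row and column of the reference node $0$. *)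

theory Defs
  imports "HOL-Analysis.Analysis"
begin

(* The node set {0,...,N} is the type 'n option: None is the reference node 0 and Some n
   ranges over the N = CARD('n) remaining nodes, so that N x N matrices over the
   non-reference nodes have type real^'n^'n. *)

type_synonym 'n line = "'n option set"

definition simple_graph :: "'v set set \<Rightarrow> bool" where
  "simple_graph E \<longleftrightarrow> (\<forall>e\<in>E. card e = 2)"

definition connected_graph :: "'v set set \<Rightarrow> bool" where
  "connected_graph E \<longleftrightarrow> (\<forall>u v. (u, v) \<in> {(x, y). {x, y} \<in> E}\<^sup>*)"

definition graph_laplacian :: "'v::finite set set \<Rightarrow> ('v set \<Rightarrow> real) \<Rightarrow> real^'v^'v" where
  "graph_laplacian E w = (\<chi> i j.
     if i = j then (\<Sum>e\<in>{e\<in>E. i \<in> e}. w e)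
     else if {i, j} \<in> E then - w {i, j} else 0)"

definition delete_reference :: "real^('n option)^('n option) \<Rightarrow> real^'n^'n" where
  "delete_reference A = (\<chi> i j. A $ Some i $ Some j)"

definition orientation :: "'v set set \<Rightarrow> ('v set \<Rightarrow> 'v \<times> 'v) \<Rightarrow> bool" where
  "orientation E ori \<longleftrightarrow> (\<forall>m\<in>E. m = {fst (ori m), snd (ori m)})"

definition incidence :: "'n option \<times> 'n option \<Rightarrow> real^'n" where
  "incidence p = (\<chi> n. if Some n = fst p then 1 else if Some n = snd p then - 1 else 0)"

definition outer :: "real^'n \<Rightarrow> real^'n^'n" where
  "outer a = (\<chi> i j. a $ i * a $ j)"

definition reduced_laplacian ::
  "'n line set \<Rightarrow> ('n line \<Rightarrow> 'n option \<times> 'n option) \<Rightarrow> ('n line \<Rightarrow> real)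
    \<Rightarrow> ('n line \<Rightarrow> real) \<Rightarrow> real^'n^'n" where
  "reduced_laplacian E ori b z = (\<Sum>m\<in>E. (z m * b m) *\<^sub>R outer (incidence (ori m)))"

definition budget_set :: "'n line set \<Rightarrow> nat \<Rightarrow> ('n line \<Rightarrow> real) set" where
  "budget_set E K = {z \<in> E \<rightarrow>\<^sub>E {0, 1}. (\<Sum>m\<in>E. z m) \<le> real K}"

definition objective :: "real^'n^'n \<Rightarrow> real^'n^'n \<Rightarrow> real" where
  "objective Wr X = trace (Wr ** X)"

definition feasible_P ::
  "'n::finite line set \<Rightarrow> ('n line \<Rightarrow> 'n option \<times> 'n option) \<Rightarrow> ('n line \<Rightarrow> real) \<Rightarrow> nat
    \<Rightarrow> (real^'n^'n) \<times> ('n line \<Rightarrow> real) \<Rightarrow> bool" where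
  "feasible_P E ori b K = (\<lambda>(X, z).
     z \<in> budget_set E K \<and> reduced_laplacian E ori b z ** X = mat 1)"

definition feasible_M ::
  "'n::finite line set \<Rightarrow> ('n line \<Rightarrow> 'n option \<times> 'n option) \<Rightarrow> ('n line \<Rightarrow> real) \<Rightarrow> nat
    \<Rightarrow> real^'n^'n \<Rightarrow> real^'n^'n
    \<Rightarrow> (real^'n^'n) \<times> ('n line \<Rightarrow> real) \<times> ('n line \<Rightarrow> real^'n^'n) \<Rightarrow> bool" where
  "feasible_M E ori b K Xlo Xup = (\<lambda>(X, z, y).
     z \<in> budget_set E K \<and> y \<in> E \<rightarrow>\<^sub>E UNIV \<and>
     (\<forall>i j. (\<Sum>m\<in>E. b m * (\<Sum>k\<in>UNIV. outer (incidence (ori m)) $ i $ k * y m $ k $ j))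
              = mat 1 $ i $ j) \<and>
     (\<forall>m\<in>E. \<forall>i j.
        y m $ i $ j \<ge> z m * Xlo $ i $ j \<and>
        y m $ i $ j \<ge> X $ i $ j + z m * Xup $ i $ j - Xup $ i $ j \<and>
        y m $ i $ j \<le> z m * Xup $ i $ j \<and>
        y m $ i $ j \<le> X $ i $ j + z m * Xlo $ i $ j - Xlo $ i $ j))"

definition optimal_P where
  "optimal_P E ori b K Wr = is_arg_min (\<lambda>(X, z). objective Wr X) (feasible_P E ori b K)"

definition optimal_M where
  "optimal_M E ori b K Xlo Xup Wr =
     is_arg_min (\<lambda>(X, z, y). objective Wr X) (feasible_M E ori b K Xlo Xup)"

(* The optimal value is an attained minimum, so having one entails having an optimal solution. *)

definition optimal_value_P where
  "optimal_value_P E ori b K Wr v \<longleftrightarrow>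
     (\<exists>X z. optimal_P E ori b K Wr (X, z) \<and> objective Wr X = v)"

definition optimal_value_M where
  "optimal_value_M E ori b K Xlo Xup Wr v \<longleftrightarrow>
     (\<exists>X z y. optimal_M E ori b K Xlo Xup Wr (X, z, y) \<and> objective Wr X = v)"

end

theory Submission
  imports Defs
begin

text \<open>
  The four inequalities imposed on an entry of \<open>y m\<close> are the McCormick envelope of the
  product of \<open>z m\<close> with an entry of \<open>X\<close>. At the two values of a binary variable the
  envelope is tight: for \<open>z m = 1\<close> two of the inequalities pin the entry to that of
  \<open>X\<close>, for \<open>z m = 0\<close> they pin it to 0, and in both cases the remaining two
  say that the entry of \<open>X\<close> lies within its bounds (\<open>mccormick_binary_iff\<close>). Once
  \<open>y\<close> is this product, the linear constraint of the mixed-integer program is the matrix equation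
  of the original problem (\<open>linearised_constraint_iff\<close>).

  Hence every feasible point of the mixed-integer program projects to a feasible point of the
  original problem with the same objective value (\<open>feasible_M_imp_feasible_P\<close>). The
  projection need not be onto, since the bounds on \<open>X\<close> may cut feasible points off, but a
  feasible point within the bounds does lift (\<open>feasible_P_imp_feasible_M\<close>), and the given
  optimal solution is one of these. So the mixed-integer program minimises the same function over a
  smaller set that still contains a minimiser, which gives equal optimal values and makes each of
  its optimal solutions optimal for the original problem.
\<close>

lemma mccormick_binary_iff:
  fixes s x y l u :: real
  assumes "s \<in> {0, 1}"
  shows "(y \<ge> s * l \<and> y \<ge> x + s * u - u \<and> y \<le> s * u \<and> y \<le> x + s * l - l) \<longleftrightarrow>
    y = s * x \<and> l \<le> x \<and> x \<le> u"
  using assms by auto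

lemma linearised_constraint_iff:
  fixes X :: "real^'n::finite^'n"
  assumes "\<And>m i j. m \<in> E \<Longrightarrow> y m $ i $ j = z m * X $ i $ j"
  shows "(\<forall>i j. (\<Sum>m\<in>E. b m * (\<Sum>k\<in>UNIV. outer (incidence (ori m)) $ i $ k * y m $ k $ j))
      = mat 1 $ i $ j) \<longleftrightarrow> reduced_laplacian E ori b z ** X = mat 1"
proof -
  have "(\<Sum>m\<in>E. b m * (\<Sum>k\<in>UNIV. outer (incidence (ori m)) $ i $ k * y m $ k $ j))
      = (reduced_laplacian E ori b z ** X) $ i $ j" for i j
  proof -
    have "(\<Sum>m\<in>E. b m * (\<Sum>k\<in>UNIV. outer (incidence (ori m)) $ i $ k * y m $ k $ j))
        = (\<Sum>m\<in>E. \<Sum>k\<in>UNIV. z m * b m * outer (incidence (ori m)) $ i $ k * X $ k $ j)"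
      by (intro sum.cong) (auto simp: assms sum_distrib_left mult_ac intro!: sum.cong)
    also have "\<dots>
        = (\<Sum>k\<in>UNIV. \<Sum>m\<in>E. z m * b m * outer (incidence (ori m)) $ i $ k * X $ k $ j)"
      by (rule sum.swap)
    also have "\<dots> = (reduced_laplacian E ori b z ** X) $ i $ j"
      by (simp add: matrix_matrix_mult_def reduced_laplacian_def sum_distrib_right)
    finally show ?thesis .
  qed
  then show ?thesis
    by (simp add: vec_eq_iff)
qed

lemma budget_set_binary:
  assumes "z \<in> budget_set E K" and "m \<in> E"
  shows "z m \<in> {0, 1}"
  using assms unfolding budget_set_def by (auto simp only: mem_Collect_eq PiE_mem)

lemma feasible_M_product:
  assumes "feasible_M E ori b K Xlo Xup (X, z, y)" and "m \<in> E"
  shows "y m $ i $ j = z m * X $ i $ j"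
proof -
  have "z m \<in> {0, 1}"
    using assms budget_set_binary by (auto simp: feasible_M_def)
  from mccormick_binary_iff[OF this] assms show ?thesis
    unfolding feasible_M_def by fast
qed

lemma feasible_M_imp_feasible_P:
  assumes "feasible_M E ori b K Xlo Xup (X, z, y)"
  shows "feasible_P E ori b K (X, z)"
  using assms linearised_constraint_iff[OF feasible_M_product[OF assms], where b = b and ori = ori]
  by (simp add: feasible_M_def feasible_P_def)

text \<open>
  The lift restricts \<open>y\<close> to \<open>E\<close> because feasibility fixes the values of \<open>y\<close>
  outside \<open>E\<close>.
\<close>

lemma feasible_P_imp_feasible_M:
  assumes "feasible_P E ori b K (X, z)"
    and "\<And>i j. Xlo $ i $ j \<le> X $ i $ j" and "\<And>i j. X $ i $ j \<le> Xup $ i $ j"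
  shows "feasible_M E ori b K Xlo Xup (X, z, \<lambda>m\<in>E. z m *\<^sub>R X)"
proof -
  let ?y = "\<lambda>m\<in>E. z m *\<^sub>R X"
  have z: "z \<in> budget_set E K" and "reduced_laplacian E ori b z ** X = mat 1"
    using assms(1) by (auto simp: feasible_P_def)
  then have "\<forall>i j. (\<Sum>m\<in>E. b m * (\<Sum>k\<in>UNIV. outer (incidence (ori m)) $ i $ k * ?y m $ k $ j))
      = mat 1 $ i $ j"
    by (subst linearised_constraint_iff[of E ?y z X]) auto
  moreover have "?y m $ i $ j \<ge> z m * Xlo $ i $ j \<and>
      ?y m $ i $ j \<ge> X $ i $ j + z m * Xup $ i $ j - Xup $ i $ j \<and>
      ?y m $ i $ j \<le> z m * Xup $ i $ j \<and>
      ?y m $ i $ j \<le> X $ i $ j + z m * Xlo $ i $ j - Xlo $ i $ j" if "m \<in> E" for m i j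
    using that assms(2,3) by (subst mccormick_binary_iff[OF budget_set_binary[OF z that]]) simp
  ultimately show ?thesis
    using z unfolding feasible_M_def by simp
qed

theorem mainTheorem1:
  fixes E F :: "'n::finite line set"
    and ori :: "'n line \<Rightarrow> 'n option \<times> 'n option"
    and b w zopt :: "'n line \<Rightarrow> real"
    and K :: nat
    and W :: "real^('n option)^('n option)"
    and Wr Xopt Xlo Xup :: "real^'n^'n"
  assumes "simple_graph E" and "orientation E ori" and "\<forall>m\<in>E. b m > 0"
    and "K \<ge> CARD('n)"
    and "simple_graph F" and "connected_graph F" and "\<forall>e\<in>F. w e \<ge> 0"
    and "W = graph_laplacian F w" and "Wr = delete_reference W"
    and "optimal_P E ori b K Wr (Xopt, zopt)"
    and "\<forall>i j. Xlo $ i $ j \<le> Xopt $ i $ j \<and> Xopt $ i $ j \<le> Xup $ i $ j"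
  shows "(\<exists>v. optimal_value_P E ori b K Wr v \<and> optimal_value_M E ori b K Xlo Xup Wr v) \<and>
    (\<forall>X z y. optimal_M E ori b K Xlo Xup Wr (X, z, y) \<longrightarrow>
       (\<forall>m\<in>E. \<forall>i j. y m $ i $ j = z m * X $ i $ j) \<and> optimal_P E ori b K Wr (X, z))"
proof -
  define yopt where "yopt = (\<lambda>m\<in>E. zopt m *\<^sub>R Xopt)"
  have feas: "feasible_P E ori b K (Xopt, zopt)"
    and least: "\<And>X z. feasible_P E ori b K (X, z) \<Longrightarrow> objective Wr Xopt \<le> objective Wr X"
    using assms(10) by (force simp: optimal_P_def is_arg_min_def not_less)+
  have lift: "feasible_M E ori b K Xlo Xup (Xopt, zopt, yopt)"
    unfolding yopt_def using feas assms(11) by (intro feasible_P_imp_feasible_M) auto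
  have "optimal_M E ori b K Xlo Xup Wr (Xopt, zopt, yopt)"
    using lift least[OF feasible_M_imp_feasible_P]
    by (force simp: optimal_M_def is_arg_min_def not_less)
  then have "optimal_value_P E ori b K Wr (objective Wr Xopt) \<and>
      optimal_value_M E ori b K Xlo Xup Wr (objective Wr Xopt)"
    using assms(10) unfolding optimal_value_P_def optimal_value_M_def by blast
  moreover have "(\<forall>m\<in>E. \<forall>i j. y m $ i $ j = z m * X $ i $ j) \<and> optimal_P E ori b K Wr (X, z)"
    if "optimal_M E ori b K Xlo Xup Wr (X, z, y)" for X z y
  proof -
    have M: "feasible_M E ori b K Xlo Xup (X, z, y)"
      and "objective Wr X \<le> objective Wr Xopt"
      using that lift by (force simp: optimal_M_def is_arg_min_def not_less)+
    then have "optimal_P E ori b K Wr (X, z)"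
      using feasible_M_imp_feasible_P[OF M] least
      by (force simp: optimal_P_def is_arg_min_def not_less)
    then show ?thesis
      using feasible_M_product[OF M] by blast
  qed
  ultimately show ?thesis
    by blast
qed

end
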